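(* In the setting described in the context (a $3$-dimensional Calabi-Yau manifold $X$ with $T^2$-symmetry given by data $W$, $\alpha_1,\alpha_2$, and the special Lagrangian $3$-torus fibration $f:X\to B$), for every $b\in B$ the period matrix $P=(P_{jk})$, $P_{jk}=-\int_{\Sigma_j}\Xi_k$, with respect to the frame $\Xi=(\Xi_1,\Xi_2,\Xi_3)$ and the basis $\Sigma_1,\Sigma_2,\Sigma_3$ of $H_1(F_b,\mathbb{Z})$ is $$P=\begin{pmatrix}1&0&0\\0&1&0\\ \int_0^{\kappa}2\operatorname{Im}\alpha_1\,dx&\int_0^{\kappa}2\operatorname{Im}\alpha_2\,dx&\int_0^{\kappa}\det W^{-1}\,dx\end{pmatrix}.$$
   Context: Setting. Let $B\subseteq\mathbb{R}^3$ be open, let $u=x+iy$ be the coordinate on $\mathbb{C}$, let $S^1=\mathbb{R}/\mathbb{Z}$, and let $$\tilde X=\{(\phi_1,\phi_2,u,t_1,t_2)\in S^1\times S^1\times\mathbb{C}\times\mathbb{R}\times\mathbb{R}\;:\;(t_1,t_2,\operatorname{Im}u)\in B\}.$$ Let $T^2$ act on $\tilde X$ by translations of $(\phi_1,\phi_2)$. Let $W=(w_{jk})$ be a $2\times2$ positive definite symmetric matrix of real smooth functions, with inverse $W^{-1}=(w^{jk})$, and let $\alpha_1,\alpha_2$ be complex-valued smooth functions, all depending only on $(u,t_1,t_2)$ and all periodic in $x=\operatorname{Re}u$ with period $\kappa>0$. Put $$\theta_j=\alpha_j\,du-\overline{\alpha}_j\,d\overline{u}+i\,d\phi_j\quad(j=1,2),$$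 $$\omega=\frac{i}{2}\det W^{-1}\,du\wedge d\overline{u}-i\sum_{j}\theta_j\wedge dt_j,\qquad \Omega=-\Big(\sum_k w^{1k}dt_k-\theta_1\Big)\wedge\Big(\sum_k w^{2k}dt_k-\theta_2\Big)\wedge du .$$ It is assumed that $(\Omega,\omega)$ is a Calabi-Yau structure on $\tilde X$: $\Omega$ and $\omega$ are closed, $\Omega$ is a nowhere vanishing holomorphic $3$-form for the complex structure it determines, and $\omega$ is a Ricci-flat Kähler form with $\omega^{3}/3!=(-1)^{3}(i/2)^{3}\,\Omega\wedge\overline{\Omega}$. (This is the general local form of a $3$-dimensional Calabi-Yau structure with $T^2$-action that is Hamiltonian with moment map $(t_1,t_2)$ and preserves $\Omega$, and with reduced holomorphic $1$-form $du$.) Let $X=\tilde X/\kappa\mathbb{Z}$, where $\kappa\mathbb{Z}$ acts by translations on $x$; $(\Omega,\omega)$ descends to a Calabi-Yau structure on $X$. The map $$f:X\to B,\qquad f(\phi_1,\phi_2,u,t_1,t_2)=(t_1,t_2,\operatorname{Im}u)$$ is a special Lagrangian $3$-torus fibration ($\omega$ and $\operatorname{Im}\Omega$ restrict to zero on the fibres). Write $F_b=f^{-1}(b)$. For $b\in B$, $\Sigma_1,\Sigma_2,\Sigma_3$ is the basis of $H_1(F_b,\mathbb{Z})$ represented by the $1$-cycles $\{x=\phi_2=0\}$, $\{x=\phi_1=0\}$, $\{\phi_1=\phi_2=0\}$ respectively (oriented by $d\phi_1$, $d\phi_2$, $dx$). The $1$-forms $\Xi_k$ on $F_b$ are $\Xi_k=(\iota_{\partial/\partial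 t_k}\omega)|_{F_b}$ for $k=1,2$ and $\Xi_3=(\iota_{\partial/\partial y}\omega)|_{F_b}$. The integrals over $x$ in $P$ are taken at fixed $(t_1,t_2,y)=b$. *)

theory Defs
  imports "HOL-Analysis.Analysis"
begin

section \<open>Smooth maps on open subsets of Euclidean spaces\<close>

primrec Ck_on :: "nat \<Rightarrow> ('a::euclidean_space \<Rightarrow> 'b::real_normed_vector) \<Rightarrow> 'a set \<Rightarrow> bool" where
  "Ck_on 0 f S \<longleftrightarrow> continuous_on S f"
| "Ck_on (Suc k) f S \<longleftrightarrow>
     (\<forall>p\<in>S. f differentiable (at p)) \<and>
     (\<forall>e\<in>Basis. Ck_on k (\<lambda>p. frechet_derivative f (at p) e) S)"

definition smooth_on :: "('a::euclidean_space \<Rightarrow> 'b::real_normed_vector) \<Rightarrow> 'a set \<Rightarrow> bool" where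
  "smooth_on f S \<longleftrightarrow> (\<forall>k. Ck_on k f S)"


section \<open>Complex-valued differential forms\<close>

text \<open>
  All manifolds below carry a global frame identifying every tangent space with one fixed
  real vector space \<open>'v\<close>.  A \<open>k\<close>-form on a manifold with points in \<open>'m\<close> takes a point and a
  sequence of tangent vectors, of which only the entries \<open>0, \<dots>, k - 1\<close> are relevant.
\<close>

type_synonym ('m, 'v) form = "'m \<Rightarrow> (nat \<Rightarrow> 'v) \<Rightarrow> complex"

text \<open>Normalised so that \<open>(a \<and> b)(v, w) = a(v) b(w) - a(w) b(v)\<close> for 1-forms.\<close>

definition wedge :: "nat \<Rightarrow> nat \<Rightarrow> ('m, 'v) form \<Rightarrow> ('m, 'v) form \<Rightarrow> ('m, 'v) form" where
  "wedge k l a b = (\<lambda>p v.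
     (\<Sum>\<sigma> | \<sigma> permutes {..<k + l}.
        of_int (sign \<sigma>) * a p (\<lambda>i. v (\<sigma> i)) * b p (\<lambda>i. v (\<sigma> (k + i)))) / (fact k * fact l))"

definition cnj_form :: "('m, 'v) form \<Rightarrow> ('m, 'v) form" where
  "cnj_form a = (\<lambda>p v. cnj (a p v))"

text \<open>Interior product with the constant vector field \<open>w\<close>.\<close>

definition contract :: "'v \<Rightarrow> ('m, 'v) form \<Rightarrow> ('m, 'v) form" where
  "contract w a = (\<lambda>p v. a p (case_nat w v))"

text \<open>Restriction of a form to a submanifold \<open>N\<close> all of whose tangent spaces are \<open>T\<close>.\<close>

definition restrict_form :: "'m set \<Rightarrow> 'v set \<Rightarrow> ('m, 'v) form \<Rightarrow> ('m, 'v) form" where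
  "restrict_form N T a = (\<lambda>p v. if p \<in> N \<and> (\<forall>i. v i \<in> T) then a p v else 0)"

definition ext_deriv ::
    "nat \<Rightarrow> ('a::real_normed_vector, 'a) form \<Rightarrow> ('a, 'a) form" where
  "ext_deriv k a = (\<lambda>p v.
     \<Sum>i\<le>k. (-1) ^ i *
       frechet_derivative (\<lambda>q. a q (\<lambda>j. if j < i then v j else v (Suc j))) (at p) (v i))"

definition smooth_form_on :: "'a set \<Rightarrow> ('a::euclidean_space, 'a) form \<Rightarrow> bool" where
  "smooth_form_on U a \<longleftrightarrow> (\<forall>v. smooth_on (\<lambda>p. a p v) U)"

definition closed_form_on :: "'a set \<Rightarrow> nat \<Rightarrow> ('a::euclidean_space, 'a) form \<Rightarrow> bool" where
  "closed_form_on U k a \<longleftrightarrow> (\<forall>p\<in>U. \<forall>v. ext_deriv k a p v = 0)"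


section \<open>Three-dimensional Calabi-Yau structures on open subsets of Euclidean spaces\<close>

definition holo_chart ::
    "('a::euclidean_space \<Rightarrow> 'a \<Rightarrow> 'a) \<Rightarrow> 'a set \<Rightarrow> ('a \<Rightarrow> complex^3) \<Rightarrow> bool" where
  "holo_chart J V z \<longleftrightarrow>
     open V \<and> smooth_on z V \<and> inj_on z V \<and> open (z ` V) \<and> smooth_on (inv_into V z) (z ` V) \<and>
     (\<forall>p\<in>V. \<forall>v. frechet_derivative z (at p) (J p v) = \<i> *s frechet_derivative z (at p) v)"

definition complex_structure_on ::
    "'a set \<Rightarrow> ('a::euclidean_space \<Rightarrow> 'a \<Rightarrow> 'a) \<Rightarrow> bool" where
  "complex_structure_on U J \<longleftrightarrow>
     (\<forall>p\<in>U. linear (J p) \<and> (\<forall>v. J p (J p v) = - v)) \<and>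
     (\<forall>p\<in>U. \<exists>V z. p \<in> V \<and> V \<subseteq> U \<and> holo_chart J V z)"

definition holo_fun_on ::
    "('a::euclidean_space \<Rightarrow> 'a \<Rightarrow> 'a) \<Rightarrow> 'a set \<Rightarrow> ('a \<Rightarrow> complex) \<Rightarrow> bool" where
  "holo_fun_on J V h \<longleftrightarrow>
     smooth_on h V \<and>
     (\<forall>p\<in>V. \<forall>v. frechet_derivative h (at p) (J p v) = \<i> * frechet_derivative h (at p) v)"

definition d_coord :: "('a::euclidean_space \<Rightarrow> complex^3) \<Rightarrow> 3 \<Rightarrow> ('a, 'a) form" where
  "d_coord z i = (\<lambda>p v. frechet_derivative z (at p) (v 0) $ i)"

text \<open>
  Such an \<open>\<Omega>\<close> determines \<open>J\<close> on \<open>U\<close>: the complexified tangent vectors annihilated by \<open>\<Omega>\<close> are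
  exactly those of type (0,1).
\<close>

definition nonvanishing_holo_3form_on ::
    "'a set \<Rightarrow> ('a::euclidean_space \<Rightarrow> 'a \<Rightarrow> 'a) \<Rightarrow> ('a, 'a) form \<Rightarrow> bool" where
  "nonvanishing_holo_3form_on U J \<Omega> \<longleftrightarrow>
     (\<forall>p\<in>U. \<exists>V z h. p \<in> V \<and> V \<subseteq> U \<and> holo_chart J V z \<and> holo_fun_on J V h \<and>
        (\<forall>q\<in>V. h q \<noteq> 0 \<and>
           (\<forall>v. \<Omega> q v =
              h q * wedge 2 1 (wedge 1 1 (d_coord z 1) (d_coord z 2)) (d_coord z 3) q v)))"

definition pair :: "'v \<Rightarrow> 'v \<Rightarrow> nat \<Rightarrow> 'v" where
  "pair v w = case_nat v (\<lambda>_. w)"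

definition kaehler_form_on ::
    "'a set \<Rightarrow> ('a::euclidean_space \<Rightarrow> 'a \<Rightarrow> 'a) \<Rightarrow> ('a, 'a) form \<Rightarrow> bool" where
  "kaehler_form_on U J \<omega> \<longleftrightarrow>
     smooth_form_on U \<omega> \<and> closed_form_on U 2 \<omega> \<and>
     (\<forall>p\<in>U. (\<forall>v. \<omega> p v \<in> \<real>) \<and>
        (\<forall>v w. \<omega> p (pair (J p v) (J p w)) = \<omega> p (pair v w)) \<and>
        (\<forall>v. v \<noteq> 0 \<longrightarrow> Re (\<omega> p (pair v (J p v))) > 0))"

definition kaehler_metric ::
    "('a \<Rightarrow> 'a \<Rightarrow> 'a) \<Rightarrow> ('a, 'a) form \<Rightarrow> 'a \<Rightarrow> 'a \<Rightarrow> 'a \<Rightarrow> real" where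
  "kaehler_metric J \<omega> p v w = Re (\<omega> p (pair v (J p w)))"

text \<open>
  \<open>levi_civita g p u v\<close> is the Levi-Civita covariant derivative at \<open>p\<close> of the constant vector
  field \<open>v\<close> in direction \<open>u\<close>, given by the Koszul formula (i.e. the Christoffel symbols).
\<close>

definition levi_civita ::
    "('a::euclidean_space \<Rightarrow> 'a \<Rightarrow> 'a \<Rightarrow> real) \<Rightarrow> 'a \<Rightarrow> 'a \<Rightarrow> 'a \<Rightarrow> 'a" where
  "levi_civita g p u v = (THE w. \<forall>z.
     2 * g p w z = frechet_derivative (\<lambda>q. g q v z) (at p) u
                 + frechet_derivative (\<lambda>q. g q u z) (at p) v
                 - frechet_derivative (\<lambda>q. g q u v) (at p) z)"

definition riemann ::
    "('a::euclidean_space \<Rightarrow> 'a \<Rightarrow> 'a \<Rightarrow> real) \<Rightarrow> 'a \<Rightarrow> 'a \<Rightarrow> 'a \<Rightarrow> 'a \<Rightarrow> 'a" where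
  "riemann g p u v w =
     frechet_derivative (\<lambda>q. levi_civita g q v w) (at p) u
   - frechet_derivative (\<lambda>q. levi_civita g q u w) (at p) v
   + levi_civita g p u (levi_civita g p v w)
   - levi_civita g p v (levi_civita g p u w)"

definition ricci ::
    "('a::euclidean_space \<Rightarrow> 'a \<Rightarrow> 'a \<Rightarrow> real) \<Rightarrow> 'a \<Rightarrow> 'a \<Rightarrow> 'a \<Rightarrow> real" where
  "ricci g p v w = (\<Sum>e\<in>Basis. riemann g p e v w \<bullet> e)"

definition calabi_yau3_on ::
    "'a set \<Rightarrow> ('a::euclidean_space, 'a) form \<Rightarrow> ('a, 'a) form \<Rightarrow> bool" where
  "calabi_yau3_on U \<Omega> \<omega> \<longleftrightarrow>
     smooth_form_on U \<Omega> \<and> closed_form_on U 3 \<Omega> \<and>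
     (\<exists>J. complex_structure_on U J \<and> nonvanishing_holo_3form_on U J \<Omega> \<and>
        kaehler_form_on U J \<omega> \<and>
        (\<forall>p\<in>U. \<forall>v w. ricci (kaehler_metric J \<omega>) p v w = 0)) \<and>
     (\<forall>p\<in>U. \<forall>v. wedge 4 2 (wedge 2 2 \<omega> \<omega>) \<omega> p v / fact 3 =
        (-1) ^ 3 * (\<i> / 2) ^ 3 * wedge 3 3 \<Omega> (cnj_form \<Omega>) p v)"


section \<open>The manifolds\<close>

quotient_type circle = real / "\<lambda>a b. a - b \<in> \<int>"
proof (rule equivpI)
  show "reflp (\<lambda>a b::real. a - b \<in> \<int>)"
    by (simp add: reflp_def)
  show "symp (\<lambda>a b::real. a - b \<in> \<int>)"
  proof (rule sympI)
    fix a b :: real assume "a - b \<in> \<int>"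
    then have "- (a - b) \<in> \<int>" by (rule Ints_minus)
    then show "b - a \<in> \<int>" by simp
  qed
  show "transp (\<lambda>a b::real. a - b \<in> \<int>)"
  proof (rule transpI)
    fix a b c :: real assume "a - b \<in> \<int>" "b - c \<in> \<int>"
    then have "(a - b) + (b - c) \<in> \<int>" by (rule Ints_add)
    then show "a - c \<in> \<int>" by simp
  qed
qed

text \<open>
  Points are tuples \<open>(\<phi>\<^sub>1, \<phi>\<^sub>2, u, t\<^sub>1, t\<^sub>2)\<close>.  The type \<open>tvec\<close> serves both as the universal
  cover and as the tangent space at any point, with respect to the coordinate frame.
\<close>

type_synonym tvec = "real \<times> real \<times> complex \<times> real \<times> real"
type_synonym pnt = "circle \<times> circle \<times> complex \<times> real \<times> real"

definition Xtilde :: "(real \<times> real \<times> real) set \<Rightarrow> pnt set" where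
  "Xtilde B = {(\<phi>1, \<phi>2, u, t1, t2). (t1, t2, Im u) \<in> B}"

definition cover :: "tvec \<Rightarrow> pnt" where
  "cover = (\<lambda>(a1, a2, u, t1, t2). (abs_circle a1, abs_circle a2, u, t1, t2))"

text \<open>
  Being a Calabi-Yau structure is a local condition, and \<open>cover\<close> is a local diffeomorphism
  respecting the coordinate frames, so it can be tested after pulling back along \<open>cover\<close>.
\<close>

definition calabi_yau3_on_Xtilde ::
    "(real \<times> real \<times> real) set \<Rightarrow> (pnt, tvec) form \<Rightarrow> (pnt, tvec) form \<Rightarrow> bool" where
  "calabi_yau3_on_Xtilde B \<Omega> \<omega> \<longleftrightarrow>
     calabi_yau3_on (cover -` Xtilde B) (\<lambda>p. \<Omega> (cover p)) (\<lambda>p. \<omega> (cover p))"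

definition translate_x :: "real \<Rightarrow> pnt \<Rightarrow> pnt" where
  "translate_x a = (\<lambda>(\<phi>1, \<phi>2, u, t1, t2). (\<phi>1, \<phi>2, u + of_real a, t1, t2))"

definition orbit :: "real \<Rightarrow> pnt \<Rightarrow> pnt set" where
  "orbit \<kappa> q = range (\<lambda>n::int. translate_x (of_int n * \<kappa>) q)"

definition quotX :: "(real \<times> real \<times> real) set \<Rightarrow> real \<Rightarrow> pnt set set" where
  "quotX B \<kappa> = orbit \<kappa> ` Xtilde B"

text \<open>
  Descent to the quotient; meaningful for maps and forms that are constant on the orbits.
\<close>

definition descend :: "('q \<Rightarrow> 'b) \<Rightarrow> 'q set \<Rightarrow> 'b" where
  "descend g C = the_elem (g ` C)"

definition descend_form :: "('q, 'v) form \<Rightarrow> ('q set, 'v) form" where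
  "descend_form a = (\<lambda>C v. descend (\<lambda>q. a q v) C)"

definition fibration :: "pnt set \<Rightarrow> real \<times> real \<times> real" where
  "fibration = descend (\<lambda>(\<phi>1, \<phi>2, u, t1, t2). (t1, t2, Im u))"

definition fibre ::
    "(real \<times> real \<times> real) set \<Rightarrow> real \<Rightarrow> real \<times> real \<times> real \<Rightarrow> pnt set set" where
  "fibre B \<kappa> b = {C \<in> quotX B \<kappa>. fibration C = b}"

definition fibre_tangent :: "tvec set" where
  "fibre_tangent = {(a1, a2, u, t1, t2). t1 = 0 \<and> t2 = 0 \<and> Im u = 0}"


section \<open>The forms\<close>

text \<open>
  The indices \<open>1, 2\<close> are elements of the two-element type \<open>2\<close> (where \<open>2 = 0\<close>).  The data
  \<open>W\<close> and \<open>\<alpha>\<close> are functions of \<open>(u, t\<^sub>1, t\<^sub>2)\<close>.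
\<close>

definition data_dom :: "(real \<times> real \<times> real) set \<Rightarrow> (complex \<times> real \<times> real) set" where
  "data_dom B = {(u, t1, t2). (t1, t2, Im u) \<in> B}"

definition base :: "pnt \<Rightarrow> complex \<times> real \<times> real" where
  "base = (\<lambda>(\<phi>1, \<phi>2, u, t1, t2). (u, t1, t2))"

definition dphi :: "2 \<Rightarrow> (pnt, tvec) form" where
  "dphi j = (\<lambda>q v. case v 0 of (a1, a2, u, t1, t2) \<Rightarrow> of_real (if j = 1 then a1 else a2))"

definition dt :: "2 \<Rightarrow> (pnt, tvec) form" where
  "dt j = (\<lambda>q v. case v 0 of (a1, a2, u, t1, t2) \<Rightarrow> of_real (if j = 1 then t1 else t2))"

definition du :: "(pnt, tvec) form" where
  "du = (\<lambda>q v. case v 0 of (a1, a2, u, t1, t2) \<Rightarrow> u)"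

definition theta :: "(2 \<Rightarrow> complex \<times> real \<times> real \<Rightarrow> complex) \<Rightarrow> 2 \<Rightarrow> (pnt, tvec) form" where
  "theta \<alpha> j = (\<lambda>q v.
     \<alpha> j (base q) * du q v - cnj (\<alpha> j (base q)) * cnj_form du q v + \<i> * dphi j q v)"

definition omega ::
    "(complex \<times> real \<times> real \<Rightarrow> real^2^2) \<Rightarrow> (2 \<Rightarrow> complex \<times> real \<times> real \<Rightarrow> complex) \<Rightarrow>
     (pnt, tvec) form" where
  "omega W \<alpha> = (\<lambda>q v.
     \<i> / 2 * of_real (det (matrix_inv (W (base q)))) * wedge 1 1 du (cnj_form du) q v
     - \<i> * (\<Sum>j\<in>UNIV. wedge 1 1 (theta \<alpha> j) (dt j) q v))"

definition zeta ::
    "(complex \<times> real \<times> real \<Rightarrow> real^2^2) \<Rightarrow> (2 \<Rightarrow> complex \<times> real \<times> real \<Rightarrow> complex) \<Rightarrow> 2 \<Rightarrow>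
     (pnt, tvec) form" where
  "zeta W \<alpha> j = (\<lambda>q v.
     (\<Sum>k\<in>UNIV. of_real (matrix_inv (W (base q)) $ j $ k) * dt k q v) - theta \<alpha> j q v)"

definition Omega ::
    "(complex \<times> real \<times> real \<Rightarrow> real^2^2) \<Rightarrow> (2 \<Rightarrow> complex \<times> real \<times> real \<Rightarrow> complex) \<Rightarrow>
     (pnt, tvec) form" where
  "Omega W \<alpha> = (\<lambda>q v. - wedge 2 1 (wedge 1 1 (zeta W \<alpha> 1) (zeta W \<alpha> 2)) du q v)"


section \<open>Periods\<close>

text \<open>The vector fields \<open>\<partial>/\<partial>t\<^sub>1\<close>, \<open>\<partial>/\<partial>t\<^sub>2\<close>, \<open>\<partial>/\<partial>y\<close>.\<close>

definition base_frame :: "3 \<Rightarrow> tvec" where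
  "base_frame k =
     (if k = 1 then (0, 0, 0, 1, 0) else if k = 2 then (0, 0, 0, 0, 1) else (0, 0, \<i>, 0, 0))"

definition Xi ::
    "(real \<times> real \<times> real) set \<Rightarrow> real \<Rightarrow> (complex \<times> real \<times> real \<Rightarrow> real^2^2) \<Rightarrow>
     (2 \<Rightarrow> complex \<times> real \<times> real \<Rightarrow> complex) \<Rightarrow> real \<times> real \<times> real \<Rightarrow> 3 \<Rightarrow>
     (pnt set, tvec) form" where
  "Xi B \<kappa> W \<alpha> b k =
     restrict_form (fibre B \<kappa> b) fibre_tangent
       (contract (base_frame k) (descend_form (omega W \<alpha>)))"

text \<open>
  Curves in the quotient are given by lifts to the universal cover.  The three loops below
  parametrise the cycles \<open>x = \<phi>\<^sub>2 = 0\<close>, \<open>x = \<phi>\<^sub>1 = 0\<close> and \<open>\<phi>\<^sub>1 = \<phi>\<^sub>2 = 0\<close> of the fibre over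
  \<open>(t\<^sub>1, t\<^sub>2, y)\<close>, oriented by \<open>d\<phi>\<^sub>1\<close>, \<open>d\<phi>\<^sub>2\<close> and \<open>dx\<close>; the last one closes up because \<open>x\<close> is
  taken modulo \<open>\<kappa>\<close>.
\<close>

definition Sigma_lift :: "real \<Rightarrow> real \<times> real \<times> real \<Rightarrow> 3 \<Rightarrow> real \<Rightarrow> tvec" where
  "Sigma_lift \<kappa> = (\<lambda>(t1, t2, y) j s.
     if j = 1 then (s, 0, Complex 0 y, t1, t2)
     else if j = 2 then (0, s, Complex 0 y, t1, t2)
     else (0, 0, Complex (\<kappa> * s) y, t1, t2))"

definition curve_integral :: "real \<Rightarrow> (real \<Rightarrow> tvec) \<Rightarrow> (pnt set, tvec) form \<Rightarrow> complex" where
  "curve_integral \<kappa> c a =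
     integral {0..1}
       (\<lambda>s. a (orbit \<kappa> (cover (c s))) (\<lambda>_. vector_derivative c (at s within {0..1})))"

definition period_matrix ::
    "(real \<times> real \<times> real) set \<Rightarrow> real \<Rightarrow> (complex \<times> real \<times> real \<Rightarrow> real^2^2) \<Rightarrow>
     (2 \<Rightarrow> complex \<times> real \<times> real \<Rightarrow> complex) \<Rightarrow> real \<times> real \<times> real \<Rightarrow> complex^3^3" where
  "period_matrix B \<kappa> W \<alpha> b =
     (\<chi> j k. - curve_integral \<kappa> (Sigma_lift \<kappa> b j) (Xi B \<kappa> W \<alpha> b k))"

end

theory Submission
  imports Defs
begin

text \<open>
  The whole computation is pointwise.  On a fibre \<open>dt\<^sub>1 = dt\<^sub>2 = dy = 0\<close>, so that
  \<open>du = dx\<close> and \<open>\<theta>\<^sub>k = i (2 Im \<alpha>\<^sub>k dx + d\<phi>\<^sub>k)\<close> there.  Contracting \<open>\<omega>\<close> with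
  \<open>\<partial>/\<partial>t\<^sub>k\<close> picks out the coefficient of \<open>dt\<^sub>k\<close> and leaves \<open>i \<theta>\<^sub>k\<close>.  Contracting with
  \<open>\<partial>/\<partial>y\<close> leaves \<open>- det W\<^sup>-\<^sup>1 dx\<close>, which comes from the wedge product of \<open>du\<close> with its
  conjugate: the terms \<open>\<theta>\<^sub>j \<and> dt\<^sub>j\<close> vanish because neither \<open>\<partial>/\<partial>y\<close> nor a tangent
  vector of the fibre has a component along \<open>t\<close>.  Hence \<open>- \<Xi>\<^sub>k = d\<phi>\<^sub>k + 2 Im \<alpha>\<^sub>k dx\<close> for
  \<open>k = 1, 2\<close> and \<open>- \<Xi>\<^sub>3 = det W\<^sup>-\<^sup>1 dx\<close> (\<open>Xi_on_fibre\<close>).  The periods over \<open>\<Sigma>\<^sub>1\<close> and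
  \<open>\<Sigma>\<^sub>2\<close> read off the constant coefficients of \<open>d\<phi>\<^sub>1\<close> and \<open>d\<phi>\<^sub>2\<close>, and the periods over
  \<open>\<Sigma>\<^sub>3\<close> integrate the coefficients of \<open>dx\<close> over one full \<open>x\<close>-period.

  Two formal points remain: \<open>\<omega>\<close> is periodic in \<open>x\<close>, so its value on an orbit is its value at
  any representative (\<open>descend_form_orbit\<close>), and \<open>\<Sigma>\<^sub>3\<close> is parametrised by \<open>{0..1}\<close> with speed
  \<open>\<kappa>\<close>, which the linear substitution \<open>x = \<kappa> s\<close> absorbs (\<open>integral_rescale_unit_interval\<close>).
\<close>

text \<open>
  A 1-form reads only the zeroth entry of its argument sequence, so the sum over permutations
  reduces to the usual two terms.
\<close>

lemma wedge_one_forms: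
  assumes "\<And>w. a p w = f (w 0)" and "\<And>w. b p w = g (w 0)"
  shows "wedge 1 1 a b p v = f (v 0) * g (v 1) - f (v 1) * g (v 0)"
proof -
  have "{..<1 + 1::nat} = {0, 1}" by auto
  then have perms: "{\<sigma>. \<sigma> permutes {..<1 + 1::nat}} = {id, Transposition.transpose 0 1}"
    by (auto simp only: permutes_doubleton_iff)
  have "id \<noteq> Transposition.transpose 0 (1::nat)"
    by (metis id_apply transpose_apply_first zero_neq_one)
  then show ?thesis
    unfolding wedge_def perms by (simp add: assms sign_swap_id sign_id)
qed

text \<open>
  The argument sequence has the shape that \<open>contract\<close> produces when a constant sequence is fed
  to a 1-form.
\<close>

lemma omega_pair:
  "omega W \<alpha> q (case_nat (a1, a2, m, s1, s2) (\<lambda>_. (c1, c2, n, r1, r2))) =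
    \<i> / 2 * of_real (det (matrix_inv (W (base q)))) * (m * cnj n - n * cnj m)
    - \<i> * ((\<alpha> 1 (base q) * m - cnj (\<alpha> 1 (base q)) * cnj m + \<i> * of_real a1) * of_real r1
         - (\<alpha> 1 (base q) * n - cnj (\<alpha> 1 (base q)) * cnj n + \<i> * of_real c1) * of_real s1
         + (\<alpha> 2 (base q) * m - cnj (\<alpha> 2 (base q)) * cnj m + \<i> * of_real a2) * of_real r2
         - (\<alpha> 2 (base q) * n - cnj (\<alpha> 2 (base q)) * cnj n + \<i> * of_real c2) * of_real s2)"
proof -
  let ?v = "case_nat (a1, a2, m, s1, s2) (\<lambda>_. (c1, c2, n, r1, r2))"
  have du: "wedge 1 1 du (cnj_form du) q ?v = m * cnj n - n * cnj m"
    by (subst wedge_one_forms[where f = "\<lambda>(a1, a2, u, t1, t2). u"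
          and g = "\<lambda>(a1, a2, u, t1, t2). cnj u"])
       (simp_all add: du_def cnj_form_def split: prod.splits)
  have \<theta>: "wedge 1 1 (theta \<alpha> j) (dt j) q ?v =
      (\<alpha> j (base q) * m - cnj (\<alpha> j (base q)) * cnj m + \<i> * of_real (if j = 1 then a1 else a2))
        * of_real (if j = 1 then r1 else r2)
    - (\<alpha> j (base q) * n - cnj (\<alpha> j (base q)) * cnj n + \<i> * of_real (if j = 1 then c1 else c2))
        * of_real (if j = 1 then s1 else s2)" for j
    by (subst wedge_one_forms[where
          f = "\<lambda>(a1, a2, u, t1, t2). \<alpha> j (base q) * u - cnj (\<alpha> j (base q)) * cnj u
                 + \<i> * of_real (if j = 1 then a1 else a2)"
          and g = "\<lambda>(a1, a2, u, t1, t2). of_real (if j = 1 then t1 else t2)"])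
       (simp_all add: theta_def dphi_def dt_def du_def cnj_form_def split: prod.splits)
  show ?thesis
    by (simp add: omega_def du[simplified] \<theta>[simplified] sum_2 algebra_simps)
qed

text \<open>
  Periodicity on the single line \<open>Im u = y\<close> suffices, since real translations preserve that line;
  negative multiples are reached by using the hypothesis at the translated point.
\<close>

lemma periodic_int_multiple:
  assumes per: "\<And>u. Im u = y \<Longrightarrow> f (u + of_real \<kappa>) = f u" and "Im u = y"
  shows "f (u + of_real (of_int n * \<kappa>)) = f u"
proof (induction n rule: int_induct[where k = 0])
  case base
  then show ?case by simp
next
  case (step1 i)
  have "f (u + of_real (of_int (i + 1) * \<kappa>)) = f ((u + of_real (of_int i * \<kappa>)) + of_real \<kappa>)"
    by (simp add: algebra_simps)
  also have "\<dots> = f (u + of_real (of_int i * \<kappa>))"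
    by (rule per) (simp add: \<open>Im u = y\<close>)
  finally show ?case using step1 by simp
next
  case (step2 i)
  have "f (u + of_real (of_int (i - 1) * \<kappa>)) = f ((u + of_real (of_int (i - 1) * \<kappa>)) + of_real \<kappa>)"
    by (rule per[symmetric]) (simp add: \<open>Im u = y\<close>)
  also have "\<dots> = f (u + of_real (of_int i * \<kappa>))"
    by (simp add: algebra_simps)
  finally show ?case using step2 by simp
qed

lemma descend_orbit:
  assumes "\<And>n::int. g (translate_x (of_int n * \<kappa>) q) = c"
  shows "descend g (orbit \<kappa> q) = c"
proof -
  have "g ` orbit \<kappa> q = {c}"
    using assms by (auto simp: orbit_def image_image)
  then show ?thesis by (simp add: descend_def)
qed

lemma descend_form_orbit:
  assumes W: "\<And>u. Im u = y \<Longrightarrow> W (u + of_real \<kappa>, t1, t2) = W (u, t1, t2)"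
    and \<alpha>: "\<And>j u. Im u = y \<Longrightarrow> \<alpha> j (u + of_real \<kappa>, t1, t2) = \<alpha> j (u, t1, t2)"
    and q: "q = (\<phi>1, \<phi>2, u, t1, t2)" "Im u = y"
  shows "descend_form (omega W \<alpha>) (orbit \<kappa> q) v = omega W \<alpha> q v"
  unfolding descend_form_def
proof (rule descend_orbit)
  fix n :: int
  let ?q = "translate_x (of_int n * \<kappa>) q"
  have "W (base ?q) = W (base q)"
    using periodic_int_multiple[of y "\<lambda>u. W (u, t1, t2)" \<kappa> u n, OF W q(2)]
    by (simp add: translate_x_def base_def q)
  moreover have "\<alpha> j (base ?q) = \<alpha> j (base q)" for j
    using periodic_int_multiple[of y "\<lambda>u. \<alpha> j (u, t1, t2)" \<kappa> u n, OF \<alpha> q(2)]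
    by (simp add: translate_x_def base_def q)
  ultimately show "omega W \<alpha> ?q v = omega W \<alpha> q v"
    by (simp add: omega_def wedge_def theta_def dphi_def dt_def du_def cnj_form_def)
qed

lemma orbit_in_fibre:
  assumes "(t1, t2, Im u) \<in> B"
  shows "orbit \<kappa> (\<phi>1, \<phi>2, u, t1, t2) \<in> fibre B \<kappa> (t1, t2, Im u)"
proof -
  have "fibration (orbit \<kappa> (\<phi>1, \<phi>2, u, t1, t2)) = (t1, t2, Im u)"
    unfolding fibration_def by (rule descend_orbit) (simp add: translate_x_def)
  with assms show ?thesis by (auto simp: fibre_def quotX_def Xtilde_def)
qed

text \<open>
  The value of \<open>\<Xi>\<^sub>k\<close> on \<open>c\<^sub>1 \<partial>/\<partial>\<phi>\<^sub>1 + c\<^sub>2 \<partial>/\<partial>\<phi>\<^sub>2 + r \<partial>/\<partial>x\<close>.  It is real, since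
  \<open>\<theta>\<^sub>k\<close> is purely imaginary and \<open>\<omega>\<close> carries the factor \<open>i\<close>.
\<close>

lemma Xi_on_fibre:
  assumes W: "\<And>u. Im u = y \<Longrightarrow> W (u + of_real \<kappa>, t1, t2) = W (u, t1, t2)"
    and \<alpha>: "\<And>j u. Im u = y \<Longrightarrow> \<alpha> j (u + of_real \<kappa>, t1, t2) = \<alpha> j (u, t1, t2)"
    and b: "(t1, t2, y) \<in> B"
  shows "Xi B \<kappa> W \<alpha> (t1, t2, y) k (orbit \<kappa> (\<phi>1, \<phi>2, Complex x y, t1, t2))
           (\<lambda>_. (c1, c2, of_real r, 0, 0)) =
    - of_real (if k = 1 then c1 + 2 * Im (\<alpha> 1 (Complex x y, t1, t2)) * r
               else if k = 2 then c2 + 2 * Im (\<alpha> 2 (Complex x y, t1, t2)) * r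
               else det (matrix_inv (W (Complex x y, t1, t2))) * r)"
proof -
  let ?q = "(\<phi>1, \<phi>2, Complex x y, t1, t2)" and ?v = "(c1, c2, complex_of_real r, 0, 0) :: tvec"
  have "Xi B \<kappa> W \<alpha> (t1, t2, y) k (orbit \<kappa> ?q) (\<lambda>_. ?v)
      = descend_form (omega W \<alpha>) (orbit \<kappa> ?q) (case_nat (base_frame k) (\<lambda>_. ?v))"
    using orbit_in_fibre[of t1 t2 "Complex x y" B \<kappa> \<phi>1 \<phi>2] b
    by (simp add: Xi_def restrict_form_def contract_def fibre_tangent_def)
  also have "\<dots> = omega W \<alpha> ?q (case_nat (base_frame k) (\<lambda>_. ?v))"
    by (rule descend_form_orbit[OF W \<alpha>]) simp_all
  also have "\<dots> = - of_real (if k = 1 then c1 + 2 * Im (\<alpha> 1 (Complex x y, t1, t2)) * r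
               else if k = 2 then c2 + 2 * Im (\<alpha> 2 (Complex x y, t1, t2)) * r
               else det (matrix_inv (W (Complex x y, t1, t2))) * r)"
  proof -
    consider "k = 1" | "k = 2" | "k = 3" using exhaust_3 by blast
    then show ?thesis
      by cases (simp_all add: omega_pair base_frame_def base_def complex_eq_iff algebra_simps)
  qed
  finally show ?thesis .
qed

text \<open>
  The substitution \<open>x = \<kappa> s\<close>.  For a non-integrable \<open>f\<close> the identity holds as well, because then
  the rescaled function is not integrable either and both sides have the default value \<open>0\<close>.
\<close>

lemma integral_rescale_unit_interval:
  fixes f :: "real \<Rightarrow> real"
  assumes "\<kappa> > 0"
  shows "integral {0..1} (\<lambda>s. complex_of_real (f (\<kappa> * s) * \<kappa>)) = of_real (integral {0..\<kappa>} f)"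
proof -
  have rescale: "((\<lambda>s. f (\<kappa> * s)) has_integral I / \<kappa>) {0..1} \<longleftrightarrow> (f has_integral I) {0..\<kappa>}" for I
    using has_integral_affinity_iff[of \<kappa> f 0 I 0 \<kappa>] assms by (simp add: field_simps)
  show ?thesis
  proof (cases "f integrable_on {0..\<kappa>}")
    case True
    then have "((\<lambda>s. f (\<kappa> * s)) has_integral integral {0..\<kappa>} f / \<kappa>) {0..1}"
      by (simp add: rescale integrable_integral)
    from has_integral_mult_left[OF this, of \<kappa>] assms
    have "((\<lambda>s. f (\<kappa> * s) * \<kappa>) has_integral integral {0..\<kappa>} f) {0..1}" by simp
    then show ?thesis by (rule integral_unique[OF has_integral_of_real])
  next
    case False
    have "\<not> (\<lambda>s. complex_of_real (f (\<kappa> * s) * \<kappa>)) integrable_on {0..1}"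
    proof
      assume "(\<lambda>s. complex_of_real (f (\<kappa> * s) * \<kappa>)) integrable_on {0..1}"
      from integrable_linear[OF this bounded_linear_Re]
      obtain I where "((\<lambda>s. f (\<kappa> * s) * \<kappa>) has_integral I) {0..1}"
        by (auto simp: o_def integrable_on_def)
      from has_integral_mult_left[OF this, of "1 / \<kappa>"] assms
      have "((\<lambda>s. f (\<kappa> * s)) has_integral I / \<kappa>) {0..1}" by simp
      with False show False by (auto simp: rescale)
    qed
    with False show ?thesis by (metis not_integrable_integral of_real_0)
  qed
qed

text \<open>
  The one-sided derivatives at the end points of the parameter interval agree with the derivative
  of the affine lift.
\<close>

lemma Sigma_lift_vector_derivative:
  assumes "s \<in> {0..1}"
  shows "vector_derivative (Sigma_lift \<kappa> (t1, t2, y) j) (at s within {0..1}) =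
    (if j = 1 then (1, 0, 0, 0, 0) else if j = 2 then (0, 1, 0, 0, 0)
     else (0, 0, of_real \<kappa>, 0, 0))"
proof -
  define d :: tvec where "d = (if j = 1 then (1, 0, 0, 0, 0) else if j = 2 then (0, 1, 0, 0, 0)
     else (0, 0, of_real \<kappa>, 0, 0))"
  have "Sigma_lift \<kappa> (t1, t2, y) j = (\<lambda>s. (0, 0, Complex 0 y, t1, t2) + s *\<^sub>R d)"
    by (auto simp: Sigma_lift_def d_def fun_eq_iff complex_eq_iff)
  then have "(Sigma_lift \<kappa> (t1, t2, y) j has_vector_derivative d) (at s within {0..1})"
    by (auto intro!: derivative_eq_intros)
  then show ?thesis
    using vector_derivative_within_closed_interval[of 0 1 s] assms by (auto simp: d_def)
qed

theorem lemma1: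
  fixes B :: "(real \<times> real \<times> real) set"
    and \<kappa> :: real
    and W :: "complex \<times> real \<times> real \<Rightarrow> real^2^2"
    and \<alpha> :: "2 \<Rightarrow> complex \<times> real \<times> real \<Rightarrow> complex"
    and t1 t2 y :: real
  assumes "open B"
    and "\<kappa> > 0"
    and "smooth_on W (data_dom B)"
    and "\<And>j. smooth_on (\<alpha> j) (data_dom B)"
    and "\<And>p. p \<in> data_dom B \<Longrightarrow> transpose (W p) = W p"
    and "\<And>p \<xi>. p \<in> data_dom B \<Longrightarrow> \<xi> \<noteq> 0 \<Longrightarrow> \<xi> \<bullet> (W p *v \<xi>) > 0"
    and "\<And>u s1 s2. (u, s1, s2) \<in> data_dom B \<Longrightarrow>
           W (u + of_real \<kappa>, s1, s2) = W (u, s1, s2)"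
    and "\<And>j u s1 s2. (u, s1, s2) \<in> data_dom B \<Longrightarrow>
           \<alpha> j (u + of_real \<kappa>, s1, s2) = \<alpha> j (u, s1, s2)"
    and "calabi_yau3_on_Xtilde B (Omega W \<alpha>) (omega W \<alpha>)"
    and "(t1, t2, y) \<in> B"
  shows "period_matrix B \<kappa> W \<alpha> (t1, t2, y) =
    vector [vector [1, 0, 0],
            vector [0, 1, 0],
            vector [of_real (integral {0..\<kappa>} (\<lambda>x. 2 * Im (\<alpha> 1 (Complex x y, t1, t2)))),
                    of_real (integral {0..\<kappa>} (\<lambda>x. 2 * Im (\<alpha> 2 (Complex x y, t1, t2)))),
                    of_real (integral {0..\<kappa>}
                      (\<lambda>x. det (matrix_inv (W (Complex x y, t1, t2)))))]]"
proof -
  have W: "W (u + of_real \<kappa>, t1, t2) = W (u, t1, t2)" if "Im u = y" for u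
    using assms(7)[of u t1 t2] assms(10) that by (simp add: data_dom_def)
  have \<alpha>: "\<alpha> j (u + of_real \<kappa>, t1, t2) = \<alpha> j (u, t1, t2)" if "Im u = y" for j u
    using assms(8)[of u t1 t2] assms(10) that by (simp add: data_dom_def)
  note Xi = Xi_on_fibre[of y W \<kappa> t1 t2 \<alpha> B, OF W \<alpha> \<open>(t1, t2, y) \<in> B\<close>]
  let ?C = "\<lambda>j k. curve_integral \<kappa> (Sigma_lift \<kappa> (t1, t2, y) j) (Xi B \<kappa> W \<alpha> (t1, t2, y) k)"
  have angle1: "?C 1 k = - (if k = 1 then 1 else 0)" for k
  proof -
    have "?C 1 k = integral {0..1::real} (\<lambda>s. - (if k = 1 then 1 else 0))"
      unfolding curve_integral_def
      by (rule integral_cong)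
         (simp add: Sigma_lift_vector_derivative,
          simp add: Sigma_lift_def cover_def Xi[where r = 0, simplified])
    then show ?thesis by simp
  qed
  have angle2: "?C 2 k = - (if k = 2 then 1 else 0)" for k
  proof -
    have "?C 2 k = integral {0..1::real} (\<lambda>s. - (if k = 2 then 1 else 0))"
      unfolding curve_integral_def
      by (rule integral_cong)
         (simp add: Sigma_lift_vector_derivative,
          simp add: Sigma_lift_def cover_def Xi[where r = 0, simplified])
    then show ?thesis by simp
  qed
  \<comment> \<open>the coefficient of \<open>dx\<close> in \<open>- \<Xi>\<^sub>k\<close>\<close>
  define g where "g = (\<lambda>(k::3) x.
      if k = 1 then 2 * Im (\<alpha> 1 (Complex x y, t1, t2))
      else if k = 2 then 2 * Im (\<alpha> 2 (Complex x y, t1, t2))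
      else det (matrix_inv (W (Complex x y, t1, t2))))"
  have horizontal: "?C 3 k = - of_real (integral {0..\<kappa>} (g k))" for k
  proof -
    have "?C 3 k = integral {0..1} (\<lambda>s. - complex_of_real (g k (\<kappa> * s) * \<kappa>))"
      unfolding curve_integral_def
      by (rule integral_cong)
         (simp add: Sigma_lift_vector_derivative,
          simp add: Sigma_lift_def cover_def Xi g_def)
    also have "\<dots> = - of_real (integral {0..\<kappa>} (g k))"
      unfolding integral_neg integral_rescale_unit_interval[OF \<open>\<kappa> > 0\<close>] ..
    finally show ?thesis .
  qed
  show ?thesis
    by (simp add: period_matrix_def vec_eq_iff forall_3 angle1 angle2 horizontal g_def)
qed

end
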